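(* Let $S$ be an inverse semigroup. Then: (1) The assignment $\alpha\mapsto (N_\alpha,\mathrm{tr}(\alpha))$ gives a one-to-one correspondence between the abelian congruences $\alpha$ of $S$ and the congruence pairs of the form $(N,0_{E(S)})$ such that $N$ is a commutative normal inverse subsemigroup of $S$. (2) The assignment $\alpha\mapsto (N_\alpha,\mathrm{tr}(\alpha))$ gives a one-to-one correspondence between the central congruences $\alpha$ of $S$ and the congruence pairs of the form $(N,0_{E(S)})$ such that $N$ is a normal inverse subsemigroup of $S$ contained in $$Z(S)=\{a\in S\mid axa^{-1}a=aa^{-1}xa \text{ for all } x\in S\}.$$
   Context: An inverse semigroup $S$ is a semigroup in which every $x$ has a unique inverse $x^{-1}$ with $xx^{-1}x=x$ and $x^{-1}xx^{-1}=x^{-1}$; it is viewed as an algebra $(S,\cdot,{}^{-1})$. $E(S)$ is the semilattice of idempotents and $0_{E(S)}$ is the equality relation on $E(S)$. A congruence of $S$ is an equivalence relation compatible with multiplication and inversion. An inverse subsemigroup (a subsemigroup closed under inversion) $N$ of $S$ is normal if $E(S)\subseteq N$ and $g^{-1}Ng\subseteq N$ for all $g\in S$. For a congruence $\alpha$ of $S$, its kernel $N_\alpha$ is the union of all $\alpha$-classes containing idempotents, and its trace $\mathrm{tr}(\alpha)$ is the restriction of $\alpha$ to $E(S)$. It is a standard fact that a congruence is uniquely determined by the pair $(N_\alpha,\mathrm{tr}(\alpha))$, called its congruence pair. For a normal inverse subsemigroup $N$ of $S$, $(N,0_{E(S)})$ is a congruence pair when: (CP1) for all $a\in S$, $e\in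 E(S)$, if $ae\in N$ and $e=a^{-1}a$ then $a\in N$; (CP2) for all $a\in N$, $e\in E(S)$, $a^{-1}ea=a^{-1}ae$. These are exactly the pairs $(N_\alpha,\mathrm{tr}(\alpha))$ of congruences $\alpha$ with $\mathrm{tr}(\alpha)=0_{E(S)}$. For congruences $\alpha,\beta$ of $S$ and an $(n+1)$-ary term $t$ ($n\ge 1$) in the language $\{\cdot,{}^{-1}\}$, the term condition $\mathrm{TC}(t,\alpha,\beta)$ says: for all $a\,\alpha\,b$ and all $u_i\,\beta\,v_i$ ($1\le i\le n$), $t(a,u_1,\dots,u_n)=t(a,v_1,\dots,v_n)$ implies $t(b,u_1,\dots,u_n)=t(b,v_1,\dots,v_n)$. We say $\alpha$ centralizes $\beta$ if $\mathrm{TC}(t,\alpha,\beta)$ holds for every term $t$ of arity $\ge 2$. A congruence $\alpha$ is abelian if $\alpha$ centralizes $\alpha$, and central if $\alpha$ centralizes $1_S=S\times S$. *)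

theory Defs
  imports Main
begin

text \<open>The inverse semigroup \<open>S\<close> is the whole type; congruences are relations on the type.\<close>

class inverse_semigroup = semigroup_mult +
  assumes ex1_inverse: "\<exists>!y. x * y * x = x \<and> y * x * y = y"

definition sinv :: "'a::inverse_semigroup \<Rightarrow> 'a" where
  "sinv x = (THE y. x * y * x = x \<and> y * x * y = y)"

lemma sinv_inverse:
  fixes x :: "'a::inverse_semigroup"
  shows "x * sinv x * x = x" and "sinv x * x * sinv x = sinv x"
  using theI'[OF ex1_inverse[of x]] unfolding sinv_def by blast+

definition idempotents :: "'a::inverse_semigroup set" where
  "idempotents = {e. e * e = e}"

definition congruence :: "('a::inverse_semigroup \<times> 'a) set \<Rightarrow> bool" where
  "congruence \<alpha> \<longleftrightarrow> equiv UNIV \<alpha> \<and>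
     (\<forall>a b c d. (a, b) \<in> \<alpha> \<longrightarrow> (c, d) \<in> \<alpha> \<longrightarrow> (a * c, b * d) \<in> \<alpha>) \<and>
     (\<forall>a b. (a, b) \<in> \<alpha> \<longrightarrow> (sinv a, sinv b) \<in> \<alpha>)"

definition cong_kernel :: "('a::inverse_semigroup \<times> 'a) set \<Rightarrow> 'a set" where
  "cong_kernel \<alpha> = \<Union> {C \<in> UNIV // \<alpha>. C \<inter> idempotents \<noteq> {}}"

definition cong_trace :: "('a::inverse_semigroup \<times> 'a) set \<Rightarrow> ('a \<times> 'a) set" where
  "cong_trace \<alpha> = \<alpha> \<inter> (idempotents \<times> idempotents)"

definition inverse_subsemigroup :: "'a::inverse_semigroup set \<Rightarrow> bool" where
  "inverse_subsemigroup N \<longleftrightarrow> (\<forall>x\<in>N. \<forall>y\<in>N. x * y \<in> N) \<and> (\<forall>x\<in>N. sinv x \<in> N)"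

definition normal_inverse_subsemigroup :: "'a::inverse_semigroup set \<Rightarrow> bool" where
  "normal_inverse_subsemigroup N \<longleftrightarrow> inverse_subsemigroup N \<and> idempotents \<subseteq> N \<and>
     (\<forall>g. \<forall>x\<in>N. sinv g * x * g \<in> N)"

definition commutative_subset :: "'a::inverse_semigroup set \<Rightarrow> bool" where
  "commutative_subset N \<longleftrightarrow> (\<forall>x\<in>N. \<forall>y\<in>N. x * y = y * x)"

text \<open>\<open>trivial_trace_congruence_pair N\<close>: the pair of \<open>N\<close> and the equality relation on the
  idempotents is a congruence pair.\<close>

definition trivial_trace_congruence_pair :: "'a::inverse_semigroup set \<Rightarrow> bool" where
  "trivial_trace_congruence_pair N \<longleftrightarrow> normal_inverse_subsemigroup N \<and>
     (\<forall>a. \<forall>e\<in>idempotents. a * e \<in> N \<longrightarrow> e = sinv a * a \<longrightarrow> a \<in> N) \<and>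
     (\<forall>a\<in>N. \<forall>e\<in>idempotents. sinv a * e * a = sinv a * a * e)"

datatype sterm = Var nat | Mult sterm sterm | Inv sterm

fun vars :: "sterm \<Rightarrow> nat set" where
  "vars (Var i) = {i}"
| "vars (Mult s t) = vars s \<union> vars t"
| "vars (Inv t) = vars t"

fun eval_term :: "(nat \<Rightarrow> 'a::inverse_semigroup) \<Rightarrow> sterm \<Rightarrow> 'a" where
  "eval_term w (Var i) = w i"
| "eval_term w (Mult s t) = eval_term w s * eval_term w t"
| "eval_term w (Inv t) = sinv (eval_term w t)"

text \<open>A term of arity \<open>Suc n\<close> has its variables among \<open>Var 0, \<dots>, Var n\<close>. The assignment
  \<open>u(0 := a)\<close> encodes the argument tuple \<open>(a, u 1, \<dots>, u n)\<close>; the values of \<open>u\<close> at \<open>0\<close> and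
  beyond \<open>n\<close> are irrelevant.\<close>

definition term_condition ::
  "nat \<Rightarrow> sterm \<Rightarrow> ('a::inverse_semigroup \<times> 'a) set \<Rightarrow> ('a \<times> 'a) set \<Rightarrow> bool" where
  "term_condition n t \<alpha> \<beta> \<longleftrightarrow>
     (\<forall>a b u v. (a, b) \<in> \<alpha> \<longrightarrow> (\<forall>i\<in>{1..n}. (u i, v i) \<in> \<beta>) \<longrightarrow>
        eval_term (u(0 := a)) t = eval_term (v(0 := a)) t \<longrightarrow>
        eval_term (u(0 := b)) t = eval_term (v(0 := b)) t)"

definition centralizes :: "('a::inverse_semigroup \<times> 'a) set \<Rightarrow> ('a \<times> 'a) set \<Rightarrow> bool" where
  "centralizes \<alpha> \<beta> \<longleftrightarrow> (\<forall>n\<ge>1. \<forall>t. vars t \<subseteq> {0..n} \<longrightarrow> term_condition n t \<alpha> \<beta>)"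

definition abelian_congruence :: "('a::inverse_semigroup \<times> 'a) set \<Rightarrow> bool" where
  "abelian_congruence \<alpha> \<longleftrightarrow> congruence \<alpha> \<and> centralizes \<alpha> \<alpha>"

definition central_congruence :: "('a::inverse_semigroup \<times> 'a) set \<Rightarrow> bool" where
  "central_congruence \<alpha> \<longleftrightarrow> congruence \<alpha> \<and> centralizes \<alpha> (UNIV \<times> UNIV)"

definition Zset :: "'a::inverse_semigroup set" where
  "Zset = {a. \<forall>x. a * x * sinv a * a = a * sinv a * x * a}"

end

theory Submission
  imports Defs
begin

text \<open>Taking the terms \<open>x y\<close> and \<open>y x z\<close> in the term condition shows that an abelian congruence
  has trivial trace and a commutative kernel, and that the kernel of a central one lies in
  \<open>Z(S)\<close>. Conversely, let \<open>N\<close> be the kernel of a congruence \<open>\<alpha>\<close> with trivial trace. If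
  \<open>a \<alpha> b\<close> then \<open>t(b, u) = k t(a, u)\<close>, where \<open>k = t(b, u) t(a, u)\<^sup>-\<^sup>1\<close> is a product of
  idempotents and conjugates \<open>p n p\<^sup>-\<^sup>1\<close> with \<open>n \<in> N\<close>. Replacing \<open>u\<close> by a \<open>\<beta>\<close>-related tuple \<open>v\<close>
  keeps the elements \<open>n\<close> and replaces each \<open>p\<close> by some \<open>q\<close> with \<open>p \<beta> q\<close>. So the term condition
  follows once \<open>p n p\<^sup>-\<^sup>1\<close> and \<open>q n q\<^sup>-\<^sup>1\<close> always agree on the intersection of their domains: for
  \<open>\<beta> = \<alpha>\<close> they are equal when \<open>N\<close> is commutative, and for \<open>\<beta> = 1\<^sub>S\<close> they agree when
  \<open>N \<subseteq> Z(S)\<close>.\<close>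

section \<open>Inverse semigroups\<close>

lemma sinv_cancel [simp]:
  fixes a :: "'a::inverse_semigroup"
  shows "a * (sinv a * a) = a" and "a * (sinv a * (a * x)) = a * x"
    and "sinv a * (a * sinv a) = sinv a" and "sinv a * (a * (sinv a * x)) = sinv a * x"
  using sinv_inverse[of a] by (metis mult.assoc)+

lemma sinv_unique:
  assumes "x * y * x = x" and "y * x * y = y"
  shows "sinv x = y"
  using ex1_inverse[of x] sinv_inverse[of x] assms by blast

lemma sinv_sinv [simp]: "sinv (sinv x) = x"
  by (rule sinv_unique) (simp_all add: mult.assoc)

lemma idempotentsD: "e \<in> idempotents \<Longrightarrow> e * e = e"
  by (simp add: idempotents_def)

lemma idempotents_assocD: "e \<in> idempotents \<Longrightarrow> e * (e * x) = e * x"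
  by (metis idempotentsD mult.assoc)

lemma sinv_idempotent: "e \<in> idempotents \<Longrightarrow> sinv e = e"
  by (rule sinv_unique) (simp_all add: idempotents_def)

lemma idempotent_mult_sinv [simp]:
  shows "x * sinv x \<in> idempotents" and "sinv x * x \<in> idempotents"
  by (simp_all add: idempotents_def mult.assoc)

text \<open>The inverse \<open>x\<close> of \<open>e * f\<close> equals \<open>f * x * e\<close>,
  which makes \<open>x\<close> idempotent. Idempotents are their own inverses, so
  \<open>x = e * f\<close>.\<close>

lemma idempotent_mult:
  fixes e f :: "'a::inverse_semigroup"
  assumes e: "e \<in> idempotents" and f: "f \<in> idempotents"
  shows "e * f \<in> idempotents"
proof -
  define x where "x = sinv (e * f)"
  have x1: "e * (f * (x * (e * f))) = e * f" and x2: "x * (e * (f * x)) = x"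
    using sinv_inverse[of "e * f"] by (simp_all add: x_def mult.assoc)
  have "sinv (e * f) = f * x * e"
  proof (rule sinv_unique)
    show "e * f * (f * x * e) * (e * f) = e * f"
      using x1 by (simp add: mult.assoc idempotents_assocD[OF e] idempotents_assocD[OF f])
    have "f * x * e * (e * f) * (f * x * e) = f * (x * (e * (f * x))) * e"
      by (simp add: mult.assoc idempotents_assocD[OF e] idempotents_assocD[OF f])
    then show "f * x * e * (e * f) * (f * x * e) = f * x * e"
      by (simp add: x2)
  qed
  then have x: "x = f * x * e"
    by (simp add: x_def)
  have "x * x = f * (x * (e * (f * x))) * e"
    by (subst (1 2) x) (simp add: mult.assoc)
  also have "\<dots> = x"
    using x x2 by simp
  finally have "x \<in> idempotents"
    by (simp add: idempotents_def)
  moreover from this have "x = e * f"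
    by (metis sinv_idempotent sinv_sinv x_def)
  ultimately show ?thesis
    by simp
qed

text \<open>As \<open>e * f\<close> and \<open>f * e\<close> are idempotent, \<open>f * e\<close> is
  an inverse of \<open>e * f\<close>, which is also its own inverse.\<close>

lemma idempotent_commute:
  fixes e f :: "'a::inverse_semigroup"
  assumes e: "e \<in> idempotents" and f: "f \<in> idempotents"
  shows "e * f = f * e"
proof -
  have ef: "e * (f * (e * f)) = e * f" and fe: "f * (e * (f * e)) = f * e"
    using idempotentsD[OF idempotent_mult[OF e f]] idempotentsD[OF idempotent_mult[OF f e]]
    by (simp_all add: mult.assoc)
  have "sinv (e * f) = f * e"
    by (rule sinv_unique)
      (simp_all add: mult.assoc idempotents_assocD[OF e] idempotents_assocD[OF f] ef fe)
  then show ?thesis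
    by (simp add: sinv_idempotent idempotent_mult e f)
qed

lemma sinv_mult [simp]:
  fixes x y :: "'a::inverse_semigroup"
  shows "sinv (x * y) = sinv y * sinv x"
proof (rule sinv_unique)
  have c: "sinv x * x * (y * sinv y) = y * sinv y * (sinv x * x)"
    by (simp add: idempotent_commute)
  have "x * y * (sinv y * sinv x) * (x * y) = x * (y * sinv y * (sinv x * x)) * y"
    by (simp add: mult.assoc)
  also have "\<dots> = x * y"
    unfolding c[symmetric] by (simp add: mult.assoc)
  finally show "x * y * (sinv y * sinv x) * (x * y) = x * y" .
  have "sinv y * sinv x * (x * y) * (sinv y * sinv x) =
      sinv y * (sinv x * x * (y * sinv y)) * sinv x"
    by (simp add: mult.assoc)
  also have "\<dots> = sinv y * sinv x"
    unfolding c by (simp add: mult.assoc)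
  finally show "sinv y * sinv x * (x * y) * (sinv y * sinv x) = sinv y * sinv x" .
qed

lemma idempotent_conj:
  fixes e g :: "'a::inverse_semigroup"
  assumes e: "e \<in> idempotents"
  shows "sinv g * e * g \<in> idempotents"
proof -
  have "sinv g * e * g * (sinv g * e * g) = sinv g * (e * (g * sinv g)) * (e * g)"
    by (simp add: mult.assoc)
  also have "\<dots> = sinv g * e * g"
    unfolding idempotent_commute[OF e idempotent_mult_sinv(1)[of g]]
    by (simp add: mult.assoc idempotents_assocD[OF e])
  finally show ?thesis
    by (simp add: idempotents_def)
qed

section \<open>Congruence pairs with trivial trace\<close>

lemma congruenceD:
  assumes "congruence \<alpha>"
  shows congruence_refl: "(a, a) \<in> \<alpha>"
    and congruence_sym: "(a, b) \<in> \<alpha> \<Longrightarrow> (b, a) \<in> \<alpha>"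
    and congruence_trans: "(a, b) \<in> \<alpha> \<Longrightarrow> (b, c) \<in> \<alpha> \<Longrightarrow> (a, c) \<in> \<alpha>"
    and congruence_mult: "(a, b) \<in> \<alpha> \<Longrightarrow> (c, d) \<in> \<alpha> \<Longrightarrow> (a * c, b * d) \<in> \<alpha>"
    and congruence_sinv: "(a, b) \<in> \<alpha> \<Longrightarrow> (sinv a, sinv b) \<in> \<alpha>"
  using assms unfolding congruence_def equiv_def
  by (auto dest: refl_onD symD transD)

lemma cong_kernel_iff:
  assumes "congruence \<alpha>"
  shows "x \<in> cong_kernel \<alpha> \<longleftrightarrow> (\<exists>e\<in>idempotents. (x, e) \<in> \<alpha>)"
  using congruence_refl[OF assms] congruence_sym[OF assms] congruence_trans[OF assms]
  unfolding cong_kernel_def quotient_def by blast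

lemma trivial_trace_congruence_pairD:
  assumes "trivial_trace_congruence_pair N"
  shows pair_normal: "normal_inverse_subsemigroup N"
    and pair_mult: "x \<in> N \<Longrightarrow> y \<in> N \<Longrightarrow> x * y \<in> N"
    and pair_sinv: "x \<in> N \<Longrightarrow> sinv x \<in> N"
    and pair_idempotent: "e \<in> idempotents \<Longrightarrow> e \<in> N"
    and pair_conj: "x \<in> N \<Longrightarrow> sinv g * x * g \<in> N"
    and pair_conj': "x \<in> N \<Longrightarrow> g * x * sinv g \<in> N"
proof -
  show "x \<in> N \<Longrightarrow> g * x * sinv g \<in> N" for g
    using assms unfolding trivial_trace_congruence_pair_def normal_inverse_subsemigroup_def
    by (metis sinv_sinv)
qed (use assms in \<open>auto simp: trivial_trace_congruence_pair_def normal_inverse_subsemigroup_def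
        inverse_subsemigroup_def\<close>)

text \<open>(CP2) for \<open>a\<close> and for its inverse, applied to the idempotents \<open>a a\<^sup>-\<^sup>1\<close> and \<open>a\<^sup>-\<^sup>1 a\<close>,
  bounds each of the two by the other.\<close>

lemma pair_sinv_commute:
  assumes N: "trivial_trace_congruence_pair N" and a: "a \<in> N"
  shows "a * sinv a = sinv a * a"
proof -
  have *: "sinv b * b = sinv b * b * (b * sinv b)" if "b \<in> N" for b
  proof -
    have "sinv b * (b * sinv b) * b = sinv b * b * (b * sinv b)"
      using N that idempotent_mult_sinv(1)[of b]
      unfolding trivial_trace_congruence_pair_def by blast
    then show ?thesis
      by (simp add: mult.assoc)
  qed
  have "a * sinv a = a * sinv a * (sinv a * a)"
    using *[OF pair_sinv[OF N a]] by simp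
  also have "\<dots> = sinv a * a * (a * sinv a)"
    by (simp add: idempotent_commute)
  also have "\<dots> = sinv a * a"
    using *[OF a] by simp
  finally show ?thesis .
qed

text \<open>Moving \<open>e\<close> past \<open>a * sinv a\<close> produces the conjugate
  \<open>sinv a * e * a\<close>, which (CP2) rewrites.\<close>

lemma pair_idempotent_commute:
  assumes N: "trivial_trace_congruence_pair N" and a: "a \<in> N" and e: "e \<in> idempotents"
  shows "e * a = a * e"
proof -
  have "e * a = e * (a * sinv a) * a"
    by (simp add: mult.assoc)
  also have "\<dots> = a * (sinv a * e * a)"
    by (simp add: idempotent_commute[OF e] mult.assoc)
  also have "\<dots> = a * (sinv a * a * e)"
    using N a e unfolding trivial_trace_congruence_pair_def by simp
  also have "\<dots> = a * e"
    by (simp add: mult.assoc)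
  finally show ?thesis .
qed

text \<open>The usual construction of a congruence from its congruence pair: the domains
  \<open>sinv a * a\<close> and \<open>sinv b * b\<close> have to be trace-related, which for a
  trivial trace means equal.\<close>

definition pair_congruence :: "'a::inverse_semigroup set \<Rightarrow> ('a \<times> 'a) set" where
  "pair_congruence N = {(a, b). sinv a * a = sinv b * b \<and> a * sinv b \<in> N}"

text \<open>The element \<open>a * sinv b\<close> of \<open>N\<close> has range
  \<open>a * sinv a\<close> and domain \<open>b * sinv b\<close>, and in \<open>N\<close> range and
  domain agree.\<close>

lemma pair_congruence_range:
  assumes N: "trivial_trace_congruence_pair N" and ab: "(a, b) \<in> pair_congruence N"
  shows "a * sinv a = b * sinv b"
proof -
  have n: "a * sinv b \<in> N" and d: "sinv a * a = sinv b * b"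
    using ab by (auto simp: pair_congruence_def)
  have "a * sinv b * sinv (a * sinv b) = a * (sinv b * b) * sinv a"
    by (simp add: mult.assoc)
  also have "\<dots> = a * sinv a"
    by (simp add: d[symmetric] mult.assoc)
  finally have 1: "a * sinv b * sinv (a * sinv b) = a * sinv a" .
  have "sinv (a * sinv b) * (a * sinv b) = b * (sinv a * a) * sinv b"
    by (simp add: mult.assoc)
  also have "\<dots> = b * sinv b"
    by (simp add: d mult.assoc)
  finally show ?thesis
    using 1 pair_sinv_commute[OF N n] by simp
qed

lemma congruence_pair_congruence:
  assumes N: "trivial_trace_congruence_pair N"
  shows "congruence (pair_congruence N)"
  unfolding congruence_def
proof (intro conjI allI impI)
  show "equiv UNIV (pair_congruence N)"
  proof (rule equivI)
    show "refl (pair_congruence N)"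
      by (auto simp: refl_on_def pair_congruence_def pair_idempotent[OF N])
    show "sym (pair_congruence N)"
    proof (rule symI)
      fix a b assume "(a, b) \<in> pair_congruence N"
      then show "(b, a) \<in> pair_congruence N"
        using pair_sinv[OF N, of "a * sinv b"] by (auto simp: pair_congruence_def)
    qed
    show "trans (pair_congruence N)"
    proof (rule transI)
      fix a b c assume ab: "(a, b) \<in> pair_congruence N" and bc: "(b, c) \<in> pair_congruence N"
      then have "sinv b * b = sinv a * a" by (simp add: pair_congruence_def)
      then have "a * sinv b * (b * sinv c) = a * sinv c"
        by (metis mult.assoc sinv_inverse(1))
      then show "(a, c) \<in> pair_congruence N"
        using pair_mult[OF N, of "a * sinv b" "b * sinv c"] ab bc
        by (auto simp: pair_congruence_def)
    qed
  qed simp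
next
  fix a b c d
  assume ab: "(a, b) \<in> pair_congruence N" and cd: "(c, d) \<in> pair_congruence N"
  define k where "k = c * sinv d"
  define e where "e = sinv a * a"
  have k: "k \<in> N" and n: "a * sinv b \<in> N" and eb: "e = sinv b * b"
    and d: "sinv c * c = sinv d * d"
    using ab cd by (auto simp: pair_congruence_def k_def e_def)
  have e: "e \<in> idempotents" by (simp add: e_def)
  have a: "a = a * sinv b * b"
    using eb by (metis e_def mult.assoc sinv_inverse(1))
  have c: "c = k * d"
    using d by (metis k_def mult.assoc sinv_inverse(1))
  have "sinv k * k = d * (sinv c * c) * sinv d"
    by (simp add: k_def mult.assoc)
  then have kk: "sinv k * k = d * sinv d"
    by (simp add: d mult.assoc)
  \<comment> \<open>Substitute \<open>c = k * d\<close>: \<open>k\<close> commutes with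
    \<open>e\<close>, and \<open>sinv k * k = d * sinv d\<close> is absorbed by
    \<open>d\<close>.\<close>
  have "sinv (a * c) * (a * c) = sinv c * e * c"
    by (simp add: e_def mult.assoc)
  also have "\<dots> = sinv d * (sinv k * (e * k)) * d"
    unfolding c by (simp add: mult.assoc)
  also have "\<dots> = sinv d * (sinv k * k * e) * d"
    by (simp add: pair_idempotent_commute[OF N k e] mult.assoc)
  also have "\<dots> = sinv d * e * d"
    unfolding kk by (simp add: mult.assoc)
  also have "\<dots> = sinv (b * d) * (b * d)"
    by (simp add: eb mult.assoc)
  finally have "sinv (a * c) * (a * c) = sinv (b * d) * (b * d)" .
  \<comment> \<open>The second factor is a conjugate of \<open>k\<close>, hence in \<open>N\<close>
    by normality.\<close>
  moreover have "a * c * sinv (b * d) = a * sinv b * (b * k * sinv b)"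
    by (subst a) (simp add: k_def mult.assoc)
  then have "a * c * sinv (b * d) \<in> N"
    using pair_mult[OF N n pair_conj'[OF N k]] by simp
  ultimately show "(a * c, b * d) \<in> pair_congruence N"
    by (simp add: pair_congruence_def)
next
  fix a b assume ab: "(a, b) \<in> pair_congruence N"
  then have n: "sinv (a * sinv b) \<in> N" and d: "sinv a * a = sinv b * b"
    using pair_sinv[OF N, of "a * sinv b"] by (auto simp: pair_congruence_def)
  \<comment> \<open>The membership condition for the inverses is a conjugate by \<open>a\<close> of
    an element of \<open>N\<close>; their domain condition is the equality of the ranges of
    \<open>a\<close> and \<open>b\<close>.\<close>
  have "sinv a * sinv (a * sinv b) * a = sinv a * (b * (sinv a * a))"
    by (simp add: mult.assoc)
  also have "\<dots> = sinv a * b"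
    by (simp add: d)
  finally show "(sinv a, sinv b) \<in> pair_congruence N"
    using pair_conj[OF N n, of a] pair_congruence_range[OF N ab]
    by (simp add: pair_congruence_def)
qed

text \<open>If \<open>x\<close> is related to an idempotent \<open>e\<close>, then
  \<open>e = sinv x * x\<close>, so \<open>x = x * e\<close> lies in \<open>N\<close>. Conversely,
  each \<open>x\<close> in \<open>N\<close> is related to its domain.\<close>

lemma kernel_pair_congruence:
  assumes N: "trivial_trace_congruence_pair N"
  shows "cong_kernel (pair_congruence N) = N"
proof -
  have "x \<in> N" if e: "e \<in> idempotents" and xe: "(x, e) \<in> pair_congruence N" for x e
  proof -
    have "sinv x * x = e" "x * e \<in> N"
      using xe by (auto simp: pair_congruence_def sinv_idempotent[OF e] idempotentsD[OF e])
    then show ?thesis by (metis sinv_cancel(1))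
  qed
  moreover have "(x, sinv x * x) \<in> pair_congruence N" if "x \<in> N" for x
    using that by (simp add: pair_congruence_def mult.assoc)
  ultimately show ?thesis
    unfolding set_eq_iff cong_kernel_iff[OF congruence_pair_congruence[OF N]]
    using idempotent_mult_sinv(2) by blast
qed

lemma trace_pair_congruence:
  assumes N: "trivial_trace_congruence_pair N"
  shows "cong_trace (pair_congruence N) = Id_on idempotents"
proof -
  have "e = f" if "e \<in> idempotents" "f \<in> idempotents" "(e, f) \<in> pair_congruence N" for e f
    using that by (simp add: pair_congruence_def sinv_idempotent idempotentsD)
  then show ?thesis
    using congruence_refl[OF congruence_pair_congruence[OF N]]
    unfolding cong_trace_def by auto
qed

section \<open>Recovering a congruence with trivial trace from its kernel\<close>

context
  fixes \<alpha> :: "('a::inverse_semigroup \<times> 'a) set"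
  assumes cong: "congruence \<alpha>" and trace: "cong_trace \<alpha> = Id_on idempotents"
begin

lemma trivial_trace_eq: "(e, f) \<in> \<alpha> \<Longrightarrow> e \<in> idempotents \<Longrightarrow> f \<in> idempotents \<Longrightarrow> e = f"
  using trace unfolding cong_trace_def by (metis Id_onE IntI SigmaI prod.inject)

lemma trivial_trace_domain: "(a, b) \<in> \<alpha> \<Longrightarrow> sinv a * a = sinv b * b"
  by (rule trivial_trace_eq) (simp_all add: cong congruence_mult congruence_sinv)

lemma trivial_trace_range: "(a, b) \<in> \<alpha> \<Longrightarrow> a * sinv a = b * sinv b"
  by (rule trivial_trace_eq) (simp_all add: cong congruence_mult congruence_sinv)

text \<open>An idempotent related to \<open>x\<close> has the same range as \<open>x\<close>, hence
  is \<open>x * sinv x\<close>.\<close>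

lemma kernel_range: "x \<in> cong_kernel \<alpha> \<longleftrightarrow> (x, x * sinv x) \<in> \<alpha>"
proof
  assume "x \<in> cong_kernel \<alpha>"
  then obtain e where e: "e \<in> idempotents" "(x, e) \<in> \<alpha>"
    using cong_kernel_iff[OF cong] by blast
  then show "(x, x * sinv x) \<in> \<alpha>"
    using trivial_trace_range[of x e] by (simp add: sinv_idempotent idempotentsD)
qed (use cong_kernel_iff[OF cong] idempotent_mult_sinv(1) in blast)

lemma trivial_trace_kernel_pair: "trivial_trace_congruence_pair (cong_kernel \<alpha>)"
  unfolding trivial_trace_congruence_pair_def normal_inverse_subsemigroup_def
    inverse_subsemigroup_def
proof (intro conjI ballI allI impI)
  note iff = cong_kernel_iff[OF cong]
  show "x * y \<in> cong_kernel \<alpha>" if "x \<in> cong_kernel \<alpha>" "y \<in> cong_kernel \<alpha>" for x y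
    using that unfolding iff by (meson cong congruence_mult idempotent_mult)
  show "sinv x \<in> cong_kernel \<alpha>" if "x \<in> cong_kernel \<alpha>" for x
    using that unfolding iff by (metis cong congruence_sinv sinv_idempotent)
  show "idempotents \<subseteq> cong_kernel \<alpha>"
    using iff congruence_refl[OF cong] by blast
  show "sinv g * x * g \<in> cong_kernel \<alpha>" if "x \<in> cong_kernel \<alpha>" for g x
    using that unfolding iff by (meson cong congruence_mult congruence_refl idempotent_conj)
  show "a \<in> cong_kernel \<alpha>" if "a * e \<in> cong_kernel \<alpha>" "e = sinv a * a" for a e
    using that by simp
  \<comment> \<open>Both sides of (CP2) are idempotent, and replacing \<open>a\<close> by a related
    idempotent \<open>g\<close> makes them equal; so they are related, and trivial trace gives
    equality.\<close>
  show "sinv a * e * a = sinv a * a * e" if a: "a \<in> cong_kernel \<alpha>" and e: "e \<in> idempotents" for a e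
  proof (rule trivial_trace_eq)
    obtain g where g: "g \<in> idempotents" "(a, g) \<in> \<alpha>"
      using a iff by blast
    have "(sinv a * e * a, g * e * g) \<in> \<alpha>" "(sinv a * a * e, g * g * e) \<in> \<alpha>"
      using g congruence_sinv[OF cong g(2)]
      by (simp_all add: sinv_idempotent cong congruence_mult congruence_refl)
    moreover have "g * e * g = g * g * e"
      by (simp add: mult.assoc idempotent_commute[OF e g(1)])
    ultimately show "(sinv a * e * a, sinv a * a * e) \<in> \<alpha>"
      by (metis cong congruence_sym congruence_trans)
  qed (simp_all add: e idempotent_conj idempotent_mult)
qed

text \<open>For the harder inclusion, \<open>a * sinv b\<close> is related to its own range, which
  is \<open>b * sinv b\<close>; multiplying by \<open>b\<close> on the right gives \<open>a\<close>
  related to \<open>b\<close>.\<close>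

lemma pair_congruence_kernel: "pair_congruence (cong_kernel \<alpha>) = \<alpha>"
proof -
  note N = trivial_trace_kernel_pair
  have "(a, b) \<in> pair_congruence (cong_kernel \<alpha>)" if ab: "(a, b) \<in> \<alpha>" for a b
  proof -
    have "(a * sinv b, b * sinv b) \<in> \<alpha>"
      using ab by (simp add: cong congruence_mult congruence_refl)
    then have "a * sinv b \<in> cong_kernel \<alpha>"
      using cong_kernel_iff[OF cong] idempotent_mult_sinv(1) by blast
    then show ?thesis
      by (simp add: pair_congruence_def trivial_trace_domain[OF ab])
  qed
  moreover have "(a, b) \<in> \<alpha>" if ab: "(a, b) \<in> pair_congruence (cong_kernel \<alpha>)" for a b
  proof -
    have n: "a * sinv b \<in> cong_kernel \<alpha>" and d: "sinv a * a = sinv b * b"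
      using ab by (auto simp: pair_congruence_def)
    have "a * sinv b * sinv (a * sinv b) = a * (sinv b * b) * sinv a"
      by (simp add: mult.assoc)
    also have "\<dots> = a * sinv a"
      by (simp add: d[symmetric] mult.assoc)
    also have "\<dots> = b * sinv b"
      by (rule pair_congruence_range[OF N ab])
    finally have "(a * sinv b, b * sinv b) \<in> \<alpha>"
      using n kernel_range by metis
    then have "(a * sinv b * b, b * sinv b * b) \<in> \<alpha>"
      by (simp add: cong congruence_mult congruence_refl)
    moreover have "a * sinv b * b = a"
      using d by (metis mult.assoc sinv_cancel(1))
    ultimately show ?thesis
      by (simp add: mult.assoc)
  qed
  ultimately show ?thesis by auto
qed

end

section \<open>Consequences of the term condition\<close>

lemma centralizesD:
  assumes "centralizes \<alpha> \<beta>" "vars t \<subseteq> {0..n}" "n \<ge> 1" "(a, b) \<in> \<alpha>"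
    and "\<And>i. i \<in> {1..n} \<Longrightarrow> (u i, v i) \<in> \<beta>"
    and "eval_term (u(0 := a)) t = eval_term (v(0 := a)) t"
  shows "eval_term (u(0 := b)) t = eval_term (v(0 := b)) t"
  using assms unfolding centralizes_def term_condition_def by blast

lemma centralizes_binary:
  assumes c: "centralizes \<alpha> \<beta>" and "(a, b) \<in> \<alpha>" "(p, q) \<in> \<beta>" "a * p = a * q"
  shows "b * p = b * q"
  using centralizesD[OF c, of "Mult (Var 0) (Var 1)" 1 a b "\<lambda>_. p" "\<lambda>_. q"] assms by simp

lemma centralizes_ternary:
  assumes c: "centralizes \<alpha> \<beta>" and "(a, b) \<in> \<alpha>" "(p, q) \<in> \<beta>" "(r, s) \<in> \<beta>"
    and "p * a * r = q * a * s"
  shows "p * b * r = q * b * s"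
  using centralizesD[OF c, of "Mult (Mult (Var 1) (Var 0)) (Var 2)" 2 a b
      "\<lambda>i. if i = 1 then p else r" "\<lambda>i. if i = 1 then q else s"] assms by simp

lemma centralizes_mono: "centralizes \<alpha> \<beta> \<Longrightarrow> \<gamma> \<subseteq> \<beta> \<Longrightarrow> centralizes \<alpha> \<gamma>"
  unfolding centralizes_def term_condition_def by blast

lemma central_imp_abelian: "central_congruence \<alpha> \<Longrightarrow> abelian_congruence \<alpha>"
  unfolding central_congruence_def abelian_congruence_def
  by (auto intro: centralizes_mono)

lemma abelian_trace:
  assumes "abelian_congruence \<alpha>"
  shows "cong_trace \<alpha> = Id_on idempotents"
proof -
  have cong: "congruence \<alpha>" and cent: "centralizes \<alpha> \<alpha>"
    using assms by (auto simp: abelian_congruence_def)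
  have *: "e = e * f" if e: "e \<in> idempotents" and f: "f \<in> idempotents" and ef: "(e, f) \<in> \<alpha>" for e f
  proof -
    have r: "(e, e * f) \<in> \<alpha>"
      using congruence_mult[OF cong congruence_refl[OF cong, of e] ef] by (simp add: idempotentsD[OF e])
    \<comment> \<open>Replacing the left factor \<open>e * f\<close> by \<open>e\<close> turns this
      into \<open>e * e = e * (e * f)\<close>.\<close>
    have "e * f * e = e * f * (e * f)"
      by (metis e f idempotent_commute idempotent_mult idempotentsD mult.assoc)
    from centralizes_binary[OF cent congruence_sym[OF cong r] r this]
    show ?thesis
      by (simp add: idempotentsD idempotents_assocD e)
  qed
  have "e = f" if e: "e \<in> idempotents" and f: "f \<in> idempotents" and ef: "(e, f) \<in> \<alpha>" for e f
    using *[OF e f ef] *[OF f e congruence_sym[OF cong ef]] idempotent_commute[OF e f] by simp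
  then show ?thesis
    using congruence_refl[OF cong] unfolding cong_trace_def by auto
qed

lemma abelian_kernel_commutative:
  assumes "abelian_congruence \<alpha>"
  shows "commutative_subset (cong_kernel \<alpha>)"
  unfolding commutative_subset_def
proof (intro ballI)
  have cong: "congruence \<alpha>" and cent: "centralizes \<alpha> \<alpha>"
    using assms by (auto simp: abelian_congruence_def)
  note trace = abelian_trace[OF assms]
  note comm = pair_idempotent_commute[OF trivial_trace_kernel_pair[OF cong trace]]
  fix x y assume x: "x \<in> cong_kernel \<alpha>" and y: "y \<in> cong_kernel \<alpha>"
  define e where "e = x * sinv x"
  define f where "f = y * sinv y"
  have e: "e \<in> idempotents" and f: "f \<in> idempotents"
    by (simp_all add: e_def f_def)
  have xe: "(e, x) \<in> \<alpha>" and yf: "(y, f) \<in> \<alpha>"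
    using x y kernel_range[OF cong trace] congruence_sym[OF cong] by (auto simp: e_def f_def)
  have fy: "f * y = y" by (simp add: f_def mult.assoc)
  \<comment> \<open>Both sides equal \<open>e * y\<close>. Replacing the middle \<open>e\<close> by
    the related \<open>x\<close> leaves \<open>y * x = x * y\<close> once \<open>f\<close> is
    absorbed by \<open>y\<close>.\<close>
  have "y * e * f = f * e * y"
    by (metis comm[OF y e] comm[OF y f] idempotent_commute[OF e f] mult.assoc fy)
  from centralizes_ternary[OF cent xe yf congruence_sym[OF cong yf] this]
  have "y * x * f = f * x * y" .
  then show "x * y = y * x"
    by (metis comm[OF x f] comm[OF y f] mult.assoc fy)
qed

lemma central_kernel_Zset:
  assumes "central_congruence \<alpha>"
  shows "cong_kernel \<alpha> \<subseteq> Zset"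
proof
  have cong: "congruence \<alpha>" and cent: "centralizes \<alpha> (UNIV \<times> UNIV)"
    using assms by (auto simp: central_congruence_def)
  note trace = abelian_trace[OF central_imp_abelian[OF assms]]
  fix a assume a: "a \<in> cong_kernel \<alpha>"
  define g where "g = a * sinv a"
  have g: "g = sinv a * a"
    using pair_sinv_commute[OF trivial_trace_kernel_pair[OF cong trace] a] by (simp add: g_def)
  have ga: "(g, a) \<in> \<alpha>"
    using a kernel_range[OF cong trace] congruence_sym[OF cong] by (auto simp: g_def)
  have gg: "g * g = g" and gaa: "g * a = a" and agg: "a * g = a"
    unfolding g by (metis idempotentsD idempotent_mult_sinv(2), metis g_def g sinv_inverse(1), simp)
  have "a * x * (sinv a * a) = a * sinv a * x * a" for x
  proof -
    \<comment> \<open>The outer factors change from \<open>g\<close> to \<open>g * x\<close> and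
      from \<open>x * g\<close> to \<open>g\<close>, which the universal relation permits; the
      middle \<open>g\<close> is then replaced by \<open>a\<close>.\<close>
    have "g * g * (x * g) = g * x * g * g"
      using gg by (metis mult.assoc)
    from centralizes_ternary[OF cent ga _ _ this]
    have "g * a * (x * g) = g * x * a * g" by simp
    then have "a * x * g = g * x * a"
      by (metis gaa agg mult.assoc)
    then show ?thesis
      by (simp only: g[symmetric] g_def[symmetric])
  qed
  then show "a \<in> Zset"
    by (simp add: Zset_def mult.assoc)
qed

section \<open>Sufficient conditions for the term condition\<close>

text \<open>For elements of a kernel with trivial trace: \<open>k\<close> and \<open>l\<close> agree on the intersection of
  their domains.\<close>

definition compatible :: "'a::inverse_semigroup \<Rightarrow> 'a \<Rightarrow> bool" where
  "compatible k l \<longleftrightarrow> k * (l * sinv l) = k * sinv k * l"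

text \<open>Compatibility by itself does not survive conjugating the two sides by different elements, so
  the induction on terms is carried by the products of conjugates.\<close>

inductive joint_conj ::
  "'a::inverse_semigroup set \<Rightarrow> ('a \<times> 'a) set \<Rightarrow> 'a \<Rightarrow> 'a \<Rightarrow> bool"
  for N \<beta> where
  conj: "n \<in> N \<Longrightarrow> (p, q) \<in> \<beta> \<Longrightarrow> joint_conj N \<beta> (p * n * sinv p) (q * n * sinv q)"
| idem: "e \<in> idempotents \<Longrightarrow> f \<in> idempotents \<Longrightarrow> joint_conj N \<beta> e f"
| mult: "joint_conj N \<beta> k l \<Longrightarrow> joint_conj N \<beta> k' l' \<Longrightarrow> joint_conj N \<beta> (k * k') (l * l')"

section \<open>Joint products of conjugates and the induction on terms\<close>

context
  fixes N :: "'a::inverse_semigroup set" and \<beta> :: "('a \<times> 'a) set"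
  assumes N: "trivial_trace_congruence_pair N"
    and \<beta>: "congruence \<beta>"
    and compat: "\<And>n p q. n \<in> N \<Longrightarrow> (p, q) \<in> \<beta> \<Longrightarrow> compatible (p * n * sinv p) (q * n * sinv q)"
begin

lemma joint_conj_mem:
  assumes "joint_conj N \<beta> k l"
  shows "k \<in> N" and "l \<in> N"
  using assms
  by (induction rule: joint_conj.induct)
    (auto intro: pair_conj'[OF N] pair_idempotent[OF N] pair_mult[OF N])

text \<open>In the product case, idempotents commute with \<open>N\<close>, so the range of a
  product is the product of the ranges and the two compatibility equations can be
  multiplied.\<close>

lemma joint_conj_compatible: "joint_conj N \<beta> k l \<Longrightarrow> compatible k l"
proof (induction rule: joint_conj.induct)
  case (conj n p q)
  then show ?case by (rule compat)
next
  case (idem e f)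
  then show ?case by (simp add: compatible_def sinv_idempotent idempotentsD)
next
  case (mult k l k' l')
  note m = joint_conj_mem[OF mult.hyps(1)] joint_conj_mem[OF mult.hyps(2)]
  have "k * k' * (l * l' * sinv (l * l')) = k * k' * (l * (l' * sinv l') * sinv l)"
    by (simp add: mult.assoc)
  also have "l * (l' * sinv l') * sinv l = l' * sinv l' * (l * sinv l)"
    by (metis idempotent_mult_sinv(1) mult.assoc pair_idempotent_commute[OF N m(2)])
  also have "k * k' * (l' * sinv l' * (l * sinv l)) = k * (k' * (l' * sinv l')) * (l * sinv l)"
    by (simp add: mult.assoc)
  also have "\<dots> = k * (l * sinv l) * (k' * (l' * sinv l'))"
    using pair_idempotent_commute[OF N pair_mult[OF N m(3) pair_idempotent[OF N]],
        of "l' * sinv l'" "l * sinv l"]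
    by (simp add: mult.assoc)
  also have "\<dots> = k * sinv k * l * (k' * sinv k' * l')"
    using mult.IH by (simp add: compatible_def)
  also have "\<dots> = k * sinv k * (k' * sinv k') * (l * l')"
    using pair_idempotent_commute[OF N m(2), of "k' * sinv k'"] by (metis idempotent_mult_sinv(1) mult.assoc)
  also have "k * sinv k * (k' * sinv k') = k * (k' * sinv k') * sinv k"
    by (metis idempotent_mult_sinv(1) mult.assoc pair_idempotent_commute[OF N pair_sinv[OF N m(1)]])
  also have "k * (k' * sinv k') * sinv k = k * k' * sinv (k * k')"
    by (simp add: mult.assoc)
  finally show ?case
    by (simp add: compatible_def)
qed

lemma joint_conj_sinv: "joint_conj N \<beta> k l \<Longrightarrow> joint_conj N \<beta> (sinv k) (sinv l)"
proof (induction rule: joint_conj.induct)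
  case (conj n p q)
  then show ?case
    using joint_conj.conj[OF pair_sinv[OF N conj(1)] conj(2)] by (simp add: mult.assoc)
next
  case (idem e f)
  then show ?case by (simp add: sinv_idempotent joint_conj.idem)
next
  case (mult k l k' l')
  then show ?case by (simp add: joint_conj.mult)
qed

lemma joint_conj_conj:
  assumes "joint_conj N \<beta> k l" and pq: "(p, q) \<in> \<beta>"
  shows "joint_conj N \<beta> (p * k * sinv p) (q * l * sinv q)"
  using assms(1)
proof (induction rule: joint_conj.induct)
  case (conj n r s)
  then show ?case
    using joint_conj.conj[OF conj(1) congruence_mult[OF \<beta> pq conj(2)]] by (simp add: mult.assoc)
next
  case (idem e f)
  then show ?case
    using idempotent_conj[of e "sinv p"] idempotent_conj[of f "sinv q"]
    by (simp add: joint_conj.idem)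
next
  case (mult k l k' l')
  \<comment> \<open>Conjugation by \<open>p\<close> is multiplicative on \<open>N\<close> because
    \<open>k\<close> commutes with \<open>sinv p * p\<close>.\<close>
  have *: "p * (k * k') * sinv p = p * k * sinv p * (p * k' * sinv p)" if "k \<in> N" for p k k'
  proof -
    have "p * k * sinv p * (p * k' * sinv p) = p * (k * (sinv p * p)) * k' * sinv p"
      by (simp add: mult.assoc)
    also have "\<dots> = p * (sinv p * p * k) * k' * sinv p"
      by (simp add: pair_idempotent_commute[OF N that])
    finally show ?thesis by (simp add: mult.assoc)
  qed
  show ?case
    using mult.IH joint_conj_mem[OF mult.hyps(1)] by (simp add: * joint_conj.mult)
qed

lemma eval_term_congruence:
  assumes "congruence \<gamma>" "\<And>i. i \<in> vars t \<Longrightarrow> (w i, z i) \<in> \<gamma>"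
  shows "(eval_term w t, eval_term z t) \<in> \<gamma>"
  using assms(2)
  by (induction t) (auto intro: congruence_mult[OF assms(1)] congruence_sinv[OF assms(1)])

lemma eval_term_joint_conj:
  assumes ab: "(a, b) \<in> pair_congruence N"
    and "\<And>i. i \<in> vars t \<Longrightarrow> i \<noteq> 0 \<Longrightarrow> (u i, v i) \<in> \<beta>"
  shows "joint_conj N \<beta> (eval_term (u(0 := b)) t * sinv (eval_term (u(0 := a)) t))
    (eval_term (v(0 := b)) t * sinv (eval_term (v(0 := a)) t))"
  using assms(2)
proof (induction t)
  note \<alpha> = congruence_pair_congruence[OF N]
  \<comment> \<open>The values at \<open>a\<close> and at \<open>b\<close> are related, so they
    share a domain. This justifies inserting \<open>sinv p * p\<close> next to \<open>r\<close> in
    both cases below.\<close>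
  have same_domain: "sinv y * y = sinv x * x"
    if "x = eval_term (w(0 := a)) t" "y = eval_term (w(0 := b)) t" for x y w t
  proof -
    have "(y, x) \<in> pair_congruence N"
      unfolding that
      by (rule congruence_sym[OF \<alpha>], rule eval_term_congruence[OF \<alpha>])
        (use ab congruence_refl[OF \<alpha>] in auto)
    then show ?thesis
      by (simp add: pair_congruence_def)
  qed
  {
    case (Var i)
    show ?case
    proof (cases "i = 0")
      case True
      define n where "n = b * sinv a"
      have n: "n \<in> N"
        using congruence_sym[OF \<alpha> ab] by (auto simp: pair_congruence_def n_def)
      \<comment> \<open>For the distinguished variable both quotients are \<open>n\<close>; writing
        it as a conjugate by its own range makes the pair an instance of
        \<open>conj\<close>.\<close>
      have "n * sinv n * n * sinv (n * sinv n) = n"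
        by (simp add: pair_sinv_commute[OF N n] mult.assoc)
          (metis mult.assoc pair_sinv_commute[OF N n] sinv_cancel(1))
      then show ?thesis
        using joint_conj.conj[OF n congruence_refl[OF \<beta>, of "n * sinv n"]] True
        by (simp add: n_def)
    next
      case False
      then show ?thesis by (simp add: joint_conj.idem)
    qed
  next
    case (Mult t1 t2)
    define p where "p w = eval_term (w(0 := a)) t1" for w
    define r where "r w = eval_term (w(0 := b)) t1" for w
    define p' where "p' w = eval_term (w(0 := a)) t2" for w
    define r' where "r' w = eval_term (w(0 := b)) t2" for w
    have pp: "(p u, p v) \<in> \<beta>"
      unfolding p_def by (rule eval_term_congruence[OF \<beta>])
        (use Mult.prems congruence_refl[OF \<beta>] in auto)
    \<comment> \<open>Writing \<open>r\<close> as \<open>r * sinv p * p\<close> splits the quotient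
      of a product into the quotient for \<open>t1\<close> and the conjugate by \<open>p\<close> of
      the quotient for \<open>t2\<close>.\<close>
    have eq: "r w * r' w * sinv (p w * p' w) =
        r w * sinv (p w) * (p w * (r' w * sinv (p' w)) * sinv (p w))" for w
    proof -
      have "r w = r w * (sinv (p w) * p w)"
        unfolding same_domain[OF p_def r_def, symmetric] by simp
      then show ?thesis by (metis mult.assoc sinv_mult)
    qed
    have j: "joint_conj N \<beta> (r u * sinv (p u)) (r v * sinv (p v))"
      "joint_conj N \<beta> (r' u * sinv (p' u)) (r' v * sinv (p' v))"
      unfolding p_def r_def p'_def r'_def
      by (rule Mult.IH; use Mult.prems in simp)+
    have "joint_conj N \<beta> (r u * r' u * sinv (p u * p' u)) (r v * r' v * sinv (p v * p' v))"
      unfolding eq by (rule joint_conj.mult[OF j(1) joint_conj_conj[OF j(2) pp]])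
    then show ?case
      by (simp only: eval_term.simps p_def r_def p'_def r'_def)
  next
    case (Inv t)
    define p where "p w = eval_term (w(0 := a)) t" for w
    define r where "r w = eval_term (w(0 := b)) t" for w
    have pp: "(p u, p v) \<in> \<beta>"
      unfolding p_def by (rule eval_term_congruence[OF \<beta>])
        (use Inv.prems congruence_refl[OF \<beta>] in auto)
    \<comment> \<open>The quotient for an inverse is the inverse of the old quotient, conjugated by
      \<open>sinv p\<close>.\<close>
    have eq: "sinv (r w) * p w = sinv (p w) * sinv (r w * sinv (p w)) * sinv (sinv (p w))" for w
    proof -
      have "sinv (p w) * sinv (r w * sinv (p w)) * sinv (sinv (p w)) =
          sinv (p w) * p w * sinv (r w) * p w"
        by (simp add: mult.assoc)
      also have "\<dots> = sinv (r w) * p w"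
        unfolding same_domain[OF p_def r_def, symmetric] by (simp add: mult.assoc)
      finally show ?thesis by simp
    qed
    have j: "joint_conj N \<beta> (r u * sinv (p u)) (r v * sinv (p v))"
      unfolding p_def r_def by (rule Inv.IH) (use Inv.prems in simp)
    have "joint_conj N \<beta> (sinv (r u) * p u) (sinv (r v) * p v)"
      unfolding eq by (rule joint_conj_conj[OF joint_conj_sinv[OF j] congruence_sinv[OF \<beta> pp]])
    then show ?case
      by (simp only: eval_term.simps p_def r_def sinv_sinv)
  }
qed

lemma pair_congruence_centralizes: "centralizes (pair_congruence N) \<beta>"
  unfolding centralizes_def term_condition_def
proof (intro allI impI)
  note \<alpha> = congruence_pair_congruence[OF N]
  fix n :: nat and t :: sterm and a b :: 'a and u v
  assume vars: "vars t \<subseteq> {0..n}" and ab: "(a, b) \<in> pair_congruence N"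
    and uv: "\<forall>i\<in>{1..n}. (u i, v i) \<in> \<beta>"
    and eq: "eval_term (u(0 := a)) t = eval_term (v(0 := a)) t"
  \<comment> \<open>\<open>w\<close> is the common value at \<open>a\<close>. The values at
    \<open>b\<close> are \<open>k * w\<close> and \<open>l * w\<close>, and the ranges of
    \<open>k\<close> and \<open>l\<close> both fix \<open>w\<close>.\<close>
  define w where "w = eval_term (u(0 := a)) t"
  define k where "k = eval_term (u(0 := b)) t * sinv w"
  define l where "l = eval_term (v(0 := b)) t * sinv w"
  have "joint_conj N \<beta> k l"
    unfolding k_def l_def using eval_term_joint_conj[OF ab, of t u v] vars uv eq
    by (fastforce simp: w_def)
  note kl = joint_conj_mem[OF this] joint_conj_compatible[OF this]
  have *: "y = y * sinv w * w \<and> y * sinv w * sinv (y * sinv w) * w = w"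
    if "y = eval_term (z(0 := b)) t" "w = eval_term (z(0 := a)) t" for y z
  proof -
    have yw: "(y, w) \<in> pair_congruence N"
      unfolding that
      by (rule congruence_sym[OF \<alpha>], rule eval_term_congruence[OF \<alpha>])
        (use ab congruence_refl[OF \<alpha>] in auto)
    have d: "sinv y * y = sinv w * w" and r: "y * sinv y = w * sinv w"
      using yw pair_congruence_range[OF N yw] by (auto simp: pair_congruence_def)
    have "y * (sinv w * w) = y"
      unfolding d[symmetric] by simp
    moreover have "y * sinv w * sinv (y * sinv w) * w = y * (sinv w * w) * (sinv y * w)"
      by (simp add: mult.assoc)
    ultimately show ?thesis
      using r by (metis mult.assoc sinv_cancel(1))
  qed
  have k: "eval_term (u(0 := b)) t = k * w" "k * sinv k * w = w"
    and l: "eval_term (v(0 := b)) t = l * w" "l * sinv l * w = w"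
    using *[OF refl, of u] *[OF refl, of v] eq unfolding k_def l_def by (auto simp: w_def)
  \<comment> \<open>Compatibility trades the range of \<open>l\<close> for that of \<open>k\<close>,
    which commutes past \<open>l\<close> and is absorbed by \<open>w\<close>.\<close>
  have "k * w = k * (l * sinv l) * w"
    using l(2) by (simp add: mult.assoc)
  also have "\<dots> = k * sinv k * l * w"
    using kl(3) by (simp add: compatible_def)
  also have "\<dots> = l * (k * sinv k * w)"
    using pair_idempotent_commute[OF N kl(2), of "k * sinv k"] by (simp add: mult.assoc)
  finally show "eval_term (u(0 := b)) t = eval_term (v(0 := b)) t"
    using k l by simp
qed

end

lemma compatible_refl:
  fixes k :: "'a::inverse_semigroup"
  assumes "k * sinv k = sinv k * k"
  shows "compatible k k"
  unfolding compatible_def assms by (metis assms mult.assoc sinv_cancel(1))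

lemma abelian_pair_congruence:
  assumes N: "trivial_trace_congruence_pair N" and comm: "commutative_subset N"
  shows "abelian_congruence (pair_congruence N)"
  unfolding abelian_congruence_def
proof (intro conjI congruence_pair_congruence[OF N] pair_congruence_centralizes[OF N])
  fix n p q
  assume n: "n \<in> N" and pq: "(p, q) \<in> pair_congruence N"
  \<comment> \<open>Since \<open>p = k * q\<close>, the conjugate by \<open>p\<close> is
    \<open>k * (q * n * sinv q) * sinv k\<close>. Commutativity brings \<open>k\<close> and
    \<open>sinv k\<close> together, and \<open>k * sinv k = q * sinv q\<close> is absorbed: the two
    conjugates are equal.\<close>
  define k where "k = p * sinv q"
  have k: "k \<in> N" and d: "sinv p * p = sinv q * q"
    using pq by (auto simp: pair_congruence_def k_def)
  have p: "p = k * q"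
    using d by (metis k_def mult.assoc sinv_cancel(1))
  have "k * sinv k = p * (sinv q * q) * sinv p"
    by (simp add: k_def mult.assoc)
  also have "\<dots> = q * sinv q"
    using pair_congruence_range[OF N pq] by (simp add: d[symmetric] mult.assoc)
  finally have kk: "k * sinv k = q * sinv q" .
  have m: "q * n * sinv q \<in> N"
    by (rule pair_conj'[OF N n])
  have "p * n * sinv p = k * (q * n * sinv q) * sinv k"
    unfolding p by (simp add: mult.assoc)
  also have "\<dots> = q * n * sinv q * (k * sinv k)"
    using comm k m unfolding commutative_subset_def by (metis mult.assoc)
  also have "\<dots> = q * n * sinv q"
    unfolding kk by (simp add: mult.assoc)
  finally show "compatible (p * n * sinv p) (q * n * sinv q)"
    using compatible_refl[OF pair_sinv_commute[OF N m]] by simp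
qed

lemma central_pair_congruence:
  assumes N: "trivial_trace_congruence_pair N" and Z: "N \<subseteq> Zset"
  shows "central_congruence (pair_congruence N)"
  unfolding central_congruence_def
proof (intro conjI congruence_pair_congruence[OF N]
    pair_congruence_centralizes[OF N])
  show "congruence (UNIV \<times> UNIV)"
    unfolding congruence_def by (auto simp: equiv_def refl_on_def sym_def trans_def)
  fix n p q
  assume n: "n \<in> N"
  have range: "q * n * sinv q * sinv (q * n * sinv q) = q * (n * sinv n) * sinv q" for q
  proof -
    have "q * n * sinv q * sinv (q * n * sinv q) = q * (n * (sinv q * q)) * sinv n * sinv q"
      by (simp add: mult.assoc)
    also have "\<dots> = q * (sinv q * q * n) * sinv n * sinv q"
      by (simp add: pair_idempotent_commute[OF N n])
    finally show ?thesis by (simp add: mult.assoc)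
  qed
  \<comment> \<open>The defining identity of \<open>Zset\<close> at \<open>x = sinv p * q\<close>,
    multiplied by \<open>p\<close> on the left and \<open>sinv q\<close> on the right, is the
    compatibility equation.\<close>
  have "n * (sinv p * q) * sinv n * n = n * sinv n * (sinv p * q) * n"
    using n Z by (auto simp: Zset_def)
  then have "p * (n * (sinv p * q) * (sinv n * n)) * sinv q =
      p * (n * sinv n * (sinv p * q) * n) * sinv q"
    by (simp add: mult.assoc)
  then show "compatible (p * n * sinv p) (q * n * sinv q)"
    unfolding compatible_def range pair_sinv_commute[OF N n, symmetric] by (simp add: mult.assoc)
qed

section \<open>The correspondence\<close>

text \<open>The common core of both correspondences, with \<open>P\<close> abelian or central and
  \<open>Q\<close> the matching condition on the kernel. The inverse map sends a pair to
  \<open>pair_congruence\<close> of its first component.\<close>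

lemma pair_correspondence:
  fixes P :: "('a::inverse_semigroup \<times> 'a) set \<Rightarrow> bool" and Q :: "'a set \<Rightarrow> bool"
  assumes abelian: "\<And>\<alpha>. P \<alpha> \<Longrightarrow> abelian_congruence \<alpha>"
    and kernel: "\<And>\<alpha>. P \<alpha> \<Longrightarrow> Q (cong_kernel \<alpha>)"
    and pair: "\<And>N. trivial_trace_congruence_pair N \<Longrightarrow> Q N \<Longrightarrow> P (pair_congruence N)"
  shows "bij_betw (\<lambda>\<alpha>. (cong_kernel \<alpha>, cong_trace \<alpha>)) {\<alpha>. P \<alpha>}
    {(N, Id_on idempotents) | N. trivial_trace_congruence_pair N \<and>
       normal_inverse_subsemigroup N \<and> Q N}"
proof (rule bij_betw_byWitness[where f' = "\<lambda>(N, _). pair_congruence N"])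
  have cong: "congruence \<alpha>" if "P \<alpha>" for \<alpha>
    using abelian[OF that] by (simp add: abelian_congruence_def)
  show "\<forall>\<alpha>\<in>{\<alpha>. P \<alpha>}. (case (cong_kernel \<alpha>, cong_trace \<alpha>) of (N, _) \<Rightarrow> pair_congruence N) = \<alpha>"
    using pair_congruence_kernel[OF cong abelian_trace[OF abelian]] by auto
  show "(\<lambda>\<alpha>. (cong_kernel \<alpha>, cong_trace \<alpha>)) ` {\<alpha>. P \<alpha>} \<subseteq>
      {(N, Id_on idempotents) | N. trivial_trace_congruence_pair N \<and>
         normal_inverse_subsemigroup N \<and> Q N}"
  proof clarify
    fix \<alpha> assume P: "P \<alpha>"
    note trace = abelian_trace[OF abelian[OF P]]
    note N = trivial_trace_kernel_pair[OF cong[OF P] trace]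
    show "\<exists>N. (cong_kernel \<alpha>, cong_trace \<alpha>) = (N, Id_on idempotents) \<and>
        trivial_trace_congruence_pair N \<and> normal_inverse_subsemigroup N \<and> Q N"
      using N pair_normal[OF N] kernel[OF P] trace by simp
  qed
qed (auto simp: kernel_pair_congruence trace_pair_congruence pair)

theorem theorem1p1:
  shows "bij_betw (\<lambda>\<alpha>. (cong_kernel \<alpha>, cong_trace \<alpha>))
           {\<alpha> :: ('a::inverse_semigroup \<times> 'a) set. abelian_congruence \<alpha>}
           {(N, Id_on idempotents) | N. trivial_trace_congruence_pair N \<and>
              normal_inverse_subsemigroup N \<and> commutative_subset N}
       \<and> bij_betw (\<lambda>\<alpha>. (cong_kernel \<alpha>, cong_trace \<alpha>))
           {\<alpha> :: ('a \<times> 'a) set. central_congruence \<alpha>}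
           {(N, Id_on idempotents) | N. trivial_trace_congruence_pair N \<and>
              normal_inverse_subsemigroup N \<and> N \<subseteq> Zset}"
proof
  show "bij_betw (\<lambda>\<alpha>. (cong_kernel \<alpha>, cong_trace \<alpha>))
      {\<alpha> :: ('a \<times> 'a) set. abelian_congruence \<alpha>}
      {(N, Id_on idempotents) | N. trivial_trace_congruence_pair N \<and>
         normal_inverse_subsemigroup N \<and> commutative_subset N}"
    by (rule pair_correspondence)
      (auto intro: abelian_kernel_commutative abelian_pair_congruence)
  show "bij_betw (\<lambda>\<alpha>. (cong_kernel \<alpha>, cong_trace \<alpha>))
      {\<alpha> :: ('a \<times> 'a) set. central_congruence \<alpha>}
      {(N, Id_on idempotents) | N. trivial_trace_congruence_pair N \<and>
         normal_inverse_subsemigroup N \<and> N \<subseteq> Zset}"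
    by (rule pair_correspondence)
      (use central_imp_abelian central_kernel_Zset central_pair_congruence in auto)
qed

end
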